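(* Let $n\ge 10$ be an integer. Then there are at least $2(n-9)\,p(n-9)$ pairs of non-isomorphic graphs of order $n$ such that the two graphs in each pair have the same resistance spectrum, where $p(n-9)$ is the number of partitions of the integer $n-9$. Here pairs are unordered and counted up to isomorphism: there are at least $2(n-9)p(n-9)$ distinct unordered pairs $\{[G],[H]\}$ of isomorphism classes of graphs on $n$ vertices with $[G]\neq[H]$ and $\mathrm{RS}(G)=\mathrm{RS}(H)$.
   Context: All graphs are finite, simple and undirected (not necessarily connected). The order of a graph is its number of vertices. The resistance distance $R_G(x,y)$ between two vertices $x,y$ of a graph $G$ is the effective resistance between $x$ and $y$ in the electrical network obtained from $G$ by replacing each edge by a unit resistor; by convention $R_G(x,y)=+\infty$ if $x$ and $y$ lie in different connected components of $G$. The resistance spectrum $\mathrm{RS}(G)$ of $G$ is the multiset of the resistance distances $R_G(x,y)$ over all unordered pairs $\{x,y\}$ of distinct vertices of $G$. A partition of a positive integer $t$ is a multiset of positive integers with sum $t$; $p(t)$ denotes the number of partitions of $t$. *)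

theory Defs
  imports
    "HOL-Library.Multiset"
    "HOL-Library.Extended_Real"
    "Graph_Theory.Graph_Theory"
begin

text \<open>
  Finite simple undirected graphs are rendered by the locale \<^locale>\<open>pair_graph\<close>: finitely many
  vertices, no loops, and every edge given by its two opposite arcs. It is enough to consider
  graphs on the vertex set \<open>{..<n}\<close>, since every isomorphism class of graphs of order \<open>n\<close> has
  a representative there.
\<close>

definition graphs_of_order :: "nat \<Rightarrow> nat pair_pre_digraph set" where
  "graphs_of_order n = {G. pair_graph G \<and> pverts G = {..<n}}"

definition iso_class :: "nat \<Rightarrow> nat pair_pre_digraph \<Rightarrow> nat pair_pre_digraph set" where
  "iso_class n G = {H \<in> graphs_of_order n. digraph_iso (with_proj G) (with_proj H)}"

text \<open>
  Every edge is a unit resistor, so by Ohm's law the current flowing from \<open>u\<close> to an adjacent \<open>w\<close> is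
  \<open>v u - v w\<close>. The predicate expresses Kirchhoff's current law at every vertex when one unit of
  current enters the network at \<open>x\<close> and leaves it at \<open>y\<close>.
\<close>

definition unit_current_potential ::
    "'a pair_pre_digraph \<Rightarrow> 'a \<Rightarrow> 'a \<Rightarrow> ('a \<Rightarrow> real) \<Rightarrow> bool" where
  "unit_current_potential G x y v \<longleftrightarrow>
     (\<forall>u \<in> pverts G. (\<Sum>w | (u, w) \<in> parcs G. v u - v w) = of_bool (u = x) - of_bool (u = y))"

text \<open>
  For \<open>x\<close> and \<open>y\<close> in one component such potentials exist, and they all have the same voltage drop
  from \<open>x\<close> to \<open>y\<close>.
\<close>

definition resistance_distance :: "'a pair_pre_digraph \<Rightarrow> 'a \<Rightarrow> 'a \<Rightarrow> ereal" where
  "resistance_distance G x y =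
     (if x \<rightarrow>\<^sup>*\<^bsub>with_proj G\<^esub> y
      then ereal (THE r. \<exists>v. unit_current_potential G x y v \<and> r = v x - v y)
      else \<infinity>)"

lemma resistance_distance_commute:
  assumes "pair_graph G"
  shows "resistance_distance G x y = resistance_distance G y x"
proof -
  interpret pair_graph G by fact
  have flip: "\<exists>v. unit_current_potential G b a v \<and> r = v b - v a"
    if "unit_current_potential G a b v" "r = v a - v b" for a b v r
  proof (intro exI[of _ "\<lambda>u. - v u"] conjI)
    have "(\<Sum>w | (u, w) \<in> parcs G. - v u - - v w) = - (\<Sum>w | (u, w) \<in> parcs G. v u - v w)" for u
      by (simp add: sum_negf[symmetric])
    then show "unit_current_potential G b a (\<lambda>u. - v u)"
      using that(1) by (auto simp: unit_current_potential_def)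
  qed (use that in simp)
  have "(\<lambda>r. \<exists>v. unit_current_potential G x y v \<and> r = v x - v y) =
        (\<lambda>r. \<exists>v. unit_current_potential G y x v \<and> r = v y - v x)"
    by (intro ext iffI; elim exE conjE; rule flip; assumption)
  moreover have "x \<rightarrow>\<^sup>*\<^bsub>with_proj G\<^esub> y \<longleftrightarrow> y \<rightarrow>\<^sup>*\<^bsub>with_proj G\<^esub> x"
    by (rule iffI; rule symmetric_reachable[OF pair_sym_arcs]; assumption)
  ultimately show ?thesis
    unfolding resistance_distance_def by (simp only:)
qed

text \<open>
  Each unordered pair of distinct vertices is counted once, through its increasing ordering; by
  symmetry of the resistance distance the choice of ordering is immaterial.
\<close>

definition resistance_spectrum :: "nat pair_pre_digraph \<Rightarrow> ereal multiset" where
  "resistance_spectrum G =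
     image_mset (\<lambda>(x, y). resistance_distance G x y)
       (mset_set {(x, y). x \<in> pverts G \<and> y \<in> pverts G \<and> x < y})"

definition num_partitions :: "nat \<Rightarrow> nat" where
  "num_partitions t = card {P :: nat multiset. 0 \<notin># P \<and> \<Sum>\<^sub># P = t}"

definition cospectral_pairs :: "nat \<Rightarrow> nat pair_pre_digraph set set set" where
  "cospectral_pairs n =
     {{iso_class n G, iso_class n H} | G H.
        G \<in> graphs_of_order n \<and> H \<in> graphs_of_order n \<and>
        iso_class n G \<noteq> iso_class n H \<and> resistance_spectrum G = resistance_spectrum H}"

end

theory Submission
  imports Defs
begin

text \<open>
  Put \<open>t = n - 9\<close>. There are five pairs of connected graphs of order nine such that the two
  graphs of a pair have the same resistance spectrum and the ten degree sequences are pairwise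
  different (\<open>base_pairs\<close>). Adding the same graph \<open>F\<close> of order \<open>t\<close> as a separate part to both members
  of a pair keeps the spectra equal, because the spectrum of a disjoint union depends only on the
  orders and the spectra of its parts (\<open>resistance_spectrum_disjoint_union\<close>).

  For \<open>F\<close> we take threshold graphs: the vertices are listed in a fixed order, and each one is joined
  either to all or to none of its predecessors. Only the first vertex has no choice to make, so there
  are \<open>2 ^ (t - 1)\<close> of them, and their degrees tell them apart (\<open>threshold_valencies_inject\<close>).

  To see that the resulting \<open>5 * 2 ^ (t - 1)\<close> pairs are different, one has to recognise the two parts
  in the union. Call a path \<open>a, b, c, d\<close> alternating if \<open>a, c\<close> and \<open>b, d\<close> are pairs of distinct
  non-adjacent vertices. A threshold graph has no such path: the largest of the four vertices would be
  adjacent to one predecessor and not to another. But every vertex of each of the ten base graphs lies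
  on one. Thus the vertices on alternating paths are those of the base graph, and the multiset that
  records for each vertex its degree and whether it lies on an alternating path determines both
  the base graph and \<open>F\<close> (\<open>padded_profile_inject\<close>).

  Finally \<open>p (t + 2) \<le> p (t + 1) + p t\<close>, so the partition numbers grow at most like the
  Fibonacci numbers, and \<open>2 * t * p t \<le> 5 * 2 ^ (t - 1)\<close> follows for \<open>t \<ge> 1\<close>.
\<close>

section \<open>An isomorphism invariant\<close>

definition valency :: "'a pair_pre_digraph \<Rightarrow> 'a \<Rightarrow> nat" where
  "valency G v = card {w. (v, w) \<in> parcs G}"

text \<open>
  It is enough that \<open>v\<close> is one of the first two vertices of the path, since arcs come in opposite
  pairs and the reverse of an alternating path is alternating.
\<close>

definition on_alternating_path :: "'a pair_pre_digraph \<Rightarrow> 'a \<Rightarrow> bool" where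
  "on_alternating_path G v \<longleftrightarrow>
     (\<exists>a b c d. (a, b) \<in> parcs G \<and> (b, c) \<in> parcs G \<and> (c, d) \<in> parcs G \<and>
        a \<noteq> c \<and> (a, c) \<notin> parcs G \<and> b \<noteq> d \<and> (b, d) \<notin> parcs G \<and> v \<in> {a, b})"

definition profile :: "'a pair_pre_digraph \<Rightarrow> (bool \<times> nat) multiset" where
  "profile G = image_mset (\<lambda>v. (on_alternating_path G v, valency G v)) (mset_set (pverts G))"

text \<open>
  A digraph isomorphism moves arcs by a map of its own. Here an arc is the pair of its ends, so that
  map is forced by the vertex map, and an isomorphism is an adjacency-preserving bijection.
\<close>

lemma digraph_iso_vertex_bijection:
  assumes "pair_wf_digraph G" "digraph_iso (with_proj G) (with_proj H)"
  obtains f where "bij_betw f (pverts G) (pverts H)"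
    "\<And>u v. u \<in> pverts G \<Longrightarrow> v \<in> pverts G \<Longrightarrow> (f u, f v) \<in> parcs H \<longleftrightarrow> (u, v) \<in> parcs G"
proof -
  interpret pair_wf_digraph G by fact
  obtain h where h: "pre_digraph.digraph_isomorphism (with_proj G) h"
    and H: "with_proj H = app_iso h (with_proj G)"
    using assms(2) by (auto simp: digraph_iso_def)
  define f where "f = iso_verts h"
  have inj: "inj_on f (pverts G)"
    and ends: "\<And>e. e \<in> parcs G \<Longrightarrow> f (fst e) = iso_tail h (iso_arcs h e) \<and> f (snd e) = iso_head h (iso_arcs h e)"
    using h by (auto simp: digraph_isomorphism_def f_def)
  have parts: "pverts H = f ` pverts G" "parcs H = iso_arcs h ` parcs G"
    "iso_tail h = fst" "iso_head h = snd"
    using H by (auto simp: with_proj_def app_iso_def f_def)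
  have img: "iso_arcs h e = (f (fst e), f (snd e))" if "e \<in> parcs G" for e
    using ends[OF that] parts by (simp add: prod_eq_iff)
  show thesis
  proof
    show "bij_betw f (pverts G) (pverts H)"
      using inj parts by (simp add: bij_betw_def)
    fix u v assume uv: "u \<in> pverts G" "v \<in> pverts G"
    show "(f u, f v) \<in> parcs H \<longleftrightarrow> (u, v) \<in> parcs G"
    proof
      assume "(f u, f v) \<in> parcs H"
      then obtain e where e: "e \<in> parcs G" "f (fst e) = f u" "f (snd e) = f v"
        unfolding parts using img by fastforce
      then have "fst e = u" "snd e = v"
        using inj uv arc_fst_in_verts[OF e(1)] arc_snd_in_verts[OF e(1)] by (auto dest: inj_onD)
      then show "(u, v) \<in> parcs G" using e(1) by auto
    next
      assume "(u, v) \<in> parcs G"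
      then show "(f u, f v) \<in> parcs H"
        unfolding parts using img[of "(u, v)"] by (intro image_eqI[of _ _ "(u, v)"]) auto
    qed
  qed
qed

lemma profile_iso_invariant:
  assumes "pair_wf_digraph G" "pair_wf_digraph H" "digraph_iso (with_proj G) (with_proj H)"
  shows "profile G = profile H"
proof -
  interpret G: pair_wf_digraph G by fact
  interpret H: pair_wf_digraph H by fact
  obtain f where bij: "bij_betw f (pverts G) (pverts H)"
    and arc: "\<And>u v. u \<in> pverts G \<Longrightarrow> v \<in> pverts G \<Longrightarrow> (f u, f v) \<in> parcs H \<longleftrightarrow> (u, v) \<in> parcs G"
    using digraph_iso_vertex_bijection[OF assms(1,3)] by blast
  have inj: "inj_on f (pverts G)" and img: "pverts H = f ` pverts G"
    using bij by (auto simp: bij_betw_def)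
  have val: "valency H (f v) = valency G v" if v: "v \<in> pverts G" for v
  proof -
    have "{w. (f v, w) \<in> parcs H} = f ` {w. (v, w) \<in> parcs G}"
    proof (intro subset_antisym subsetI)
      fix y assume "y \<in> {w. (f v, w) \<in> parcs H}"
      then have y: "(f v, y) \<in> parcs H" by simp
      then obtain w where w: "w \<in> pverts G" "y = f w"
        using H.in_arcsD2 img by blast
      then show "y \<in> f ` {w. (v, w) \<in> parcs G}" using y arc[OF v w(1)] by auto
    next
      fix y assume "y \<in> f ` {w. (v, w) \<in> parcs G}"
      then obtain w where "(v, w) \<in> parcs G" "y = f w" by auto
      then show "y \<in> {w. (f v, w) \<in> parcs H}" using arc[OF v] G.in_arcsD2 by auto
    qed
    moreover have "inj_on f {w. (v, w) \<in> parcs G}"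
      using inj G.in_arcsD2 by (auto intro: inj_on_subset)
    ultimately show ?thesis by (simp add: valency_def card_image)
  qed
  have alt: "on_alternating_path H (f v) \<longleftrightarrow> on_alternating_path G v" if v: "v \<in> pverts G" for v
  proof
    assume "on_alternating_path G v"
    then obtain a b c d where p: "(a, b) \<in> parcs G" "(b, c) \<in> parcs G" "(c, d) \<in> parcs G"
      "a \<noteq> c" "(a, c) \<notin> parcs G" "b \<noteq> d" "(b, d) \<notin> parcs G" "v \<in> {a, b}"
      by (auto simp: on_alternating_path_def)
    then have V: "a \<in> pverts G" "b \<in> pverts G" "c \<in> pverts G" "d \<in> pverts G"
      using G.wellformed' by blast+
    have "f a \<noteq> f c" "f b \<noteq> f d" using inj V p by (auto dest: inj_onD)
    then show "on_alternating_path H (f v)"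
      unfolding on_alternating_path_def using p V
      by (intro exI[of _ "f a"] exI[of _ "f b"] exI[of _ "f c"] exI[of _ "f d"]) (auto simp: arc)
  next
    assume "on_alternating_path H (f v)"
    then obtain a b c d where p: "(a, b) \<in> parcs H" "(b, c) \<in> parcs H" "(c, d) \<in> parcs H"
      "a \<noteq> c" "(a, c) \<notin> parcs H" "b \<noteq> d" "(b, d) \<notin> parcs H" "f v \<in> {a, b}"
      by (auto simp: on_alternating_path_def)
    then have "a \<in> f ` pverts G" "b \<in> f ` pverts G" "c \<in> f ` pverts G" "d \<in> f ` pverts G"
      using H.wellformed' img by blast+
    then obtain a' b' c' d' where V: "a' \<in> pverts G" "b' \<in> pverts G" "c' \<in> pverts G" "d' \<in> pverts G"
      and e: "a = f a'" "b = f b'" "c = f c'" "d = f d'" by blast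
    have "v \<in> {a', b'}" using inj p(8) V v e by (auto dest: inj_onD)
    then show "on_alternating_path G v"
      unfolding on_alternating_path_def using p V
      by (intro exI[of _ a'] exI[of _ b'] exI[of _ c'] exI[of _ d']) (auto simp: arc e)
  qed
  have "profile H = image_mset (\<lambda>v. (on_alternating_path H v, valency H v)) (image_mset f (mset_set (pverts G)))"
    by (simp add: profile_def img image_mset_mset_set[OF inj])
  also have "\<dots> = image_mset (\<lambda>v. (on_alternating_path H (f v), valency H (f v))) (mset_set (pverts G))"
    by (simp add: multiset.map_comp comp_def)
  also have "\<dots> = profile G"
  proof (cases "finite (pverts G)")
    case True
    then show ?thesis unfolding profile_def by (intro image_mset_cong) (simp add: alt val)
  qed (simp add: profile_def)
  finally show ?thesis by simp
qed

text \<open>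
  The class of \<open>H\<close> contains \<open>H\<close>, so equal classes give an isomorphism.
\<close>

lemma iso_class_eq_imp_profile_eq:
  assumes "G \<in> graphs_of_order n" "H \<in> graphs_of_order n" "iso_class n G = iso_class n H"
  shows "profile G = profile H"
proof -
  have wf: "pair_wf_digraph G" "pair_wf_digraph H"
    using assms(1,2) by (auto simp: graphs_of_order_def pair_graph_def pair_digraph_def pair_fin_digraph_def)
  interpret pair_wf_digraph H by fact
  let ?id = "\<lparr>iso_verts = id, iso_arcs = id, iso_head = snd, iso_tail = fst\<rparr>"
  have "digraph_isomorphism ?id"
    by (simp add: digraph_isomorphism_def wf_digraph_axioms)
  moreover have "with_proj H = app_iso ?id (with_proj H)"
    by (simp add: app_iso_def with_proj_def)
  ultimately have "digraph_iso (with_proj H) (with_proj H)"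
    unfolding digraph_iso_def by blast
  then have "H \<in> iso_class n G" using assms by (simp add: iso_class_def)
  then show ?thesis using profile_iso_invariant[OF wf] by (simp add: iso_class_def)
qed

section \<open>Resistance distances in disjoint unions\<close>

lemma reachable_stays_in_component:
  assumes AX: "A \<subseteq> X \<times> X" and BY: "B \<subseteq> Y \<times> Y" and "X \<inter> Y = {}"
    and r: "x \<rightarrow>\<^sup>*\<^bsub>with_proj \<lparr>pverts = X \<union> Y, parcs = A \<union> B\<rparr>\<^esub> y" and x: "x \<in> X"
  shows "y \<in> X \<and> x \<rightarrow>\<^sup>*\<^bsub>with_proj \<lparr>pverts = X, parcs = A\<rparr>\<^esub> y"
  using r[unfolded reachable_def]
proof (induction rule: rtrancl_on_induct)
  case base
  then show ?case using x by (simp add: reachable_def)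
next
  case (step y z)
  then have yz: "(y, z) \<in> A" using assms by auto
  then have "z \<in> X" using AX by auto
  then show ?case using step yz x
    by (auto simp: reachable_def intro: rtrancl_on_into_rtrancl_on)
qed

text \<open>
  Kirchhoff's law at a vertex of \<open>X\<close> involves only vertices of \<open>X\<close>, and if current enters and leaves
  inside \<open>X\<close>, the constant potential \<open>0\<close> solves the equations on \<open>Y\<close>.
\<close>

lemma resistance_distance_within_component:
  assumes AX: "A \<subseteq> X \<times> X" and BY: "B \<subseteq> Y \<times> Y" and XY: "X \<inter> Y = {}"
    and x: "x \<in> X" and y: "y \<in> X"
  shows "resistance_distance \<lparr>pverts = X \<union> Y, parcs = A \<union> B\<rparr> x y =
         resistance_distance \<lparr>pverts = X, parcs = A\<rparr> x y"
proof -
  let ?G = "\<lparr>pverts = X \<union> Y, parcs = A \<union> B\<rparr>" and ?H = "\<lparr>pverts = X, parcs = A\<rparr>"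
  have reach: "x \<rightarrow>\<^sup>*\<^bsub>with_proj ?G\<^esub> y \<longleftrightarrow> x \<rightarrow>\<^sup>*\<^bsub>with_proj ?H\<^esub> y"
  proof
    assume "x \<rightarrow>\<^sup>*\<^bsub>with_proj ?G\<^esub> y"
    then show "x \<rightarrow>\<^sup>*\<^bsub>with_proj ?H\<^esub> y"
      using reachable_stays_in_component[OF AX BY XY _ x] by blast
  next
    assume "x \<rightarrow>\<^sup>*\<^bsub>with_proj ?H\<^esub> y"
    then show "x \<rightarrow>\<^sup>*\<^bsub>with_proj ?G\<^esub> y"
      unfolding reachable_def by (rule rtrancl_on_mono[rotated -1]) auto
  qed
  have nX: "{w. (u, w) \<in> A \<union> B} = {w. (u, w) \<in> A}" if "u \<in> X" for u
    using that BY XY by auto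
  have nY: "{w. (u, w) \<in> A \<union> B} = {w. (u, w) \<in> B}" if "u \<in> Y" for u
    using that AX XY by auto
  have GH: "unit_current_potential ?H x y v" if v: "unit_current_potential ?G x y v" for v
    unfolding unit_current_potential_def
  proof
    fix u assume "u \<in> pverts ?H"
    then have u: "u \<in> X" by simp
    have "(\<Sum>w | (u, w) \<in> A \<union> B. v u - v w) = of_bool (u = x) - of_bool (u = y)"
      using v u by (simp add: unit_current_potential_def)
    then show "(\<Sum>w | (u, w) \<in> parcs ?H. v u - v w) = of_bool (u = x) - of_bool (u = y)"
      by (simp only: nX[OF u] pair_pre_digraph.simps)
  qed
  have HG: "unit_current_potential ?G x y (\<lambda>u. if u \<in> X then v u else 0)"
    if v: "unit_current_potential ?H x y v" for v
    unfolding unit_current_potential_def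
  proof
    let ?v = "\<lambda>u. if u \<in> X then v u else 0"
    fix u assume "u \<in> pverts ?G"
    then consider "u \<in> X" | "u \<in> Y" by auto
    then show "(\<Sum>w | (u, w) \<in> parcs ?G. ?v u - ?v w) = of_bool (u = x) - of_bool (u = y)"
    proof cases
      case 1
      have "(\<Sum>w | (u, w) \<in> parcs ?G. ?v u - ?v w) = (\<Sum>w | (u, w) \<in> A. v u - v w)"
        unfolding pair_pre_digraph.simps nX[OF 1] using 1 AX by (intro sum.cong) auto
      then show ?thesis using v 1 by (simp add: unit_current_potential_def)
    next
      case 2
      have "(\<Sum>w | (u, w) \<in> parcs ?G. ?v u - ?v w) = 0"
        unfolding pair_pre_digraph.simps nY[OF 2] using 2 BY XY by (intro sum.neutral) auto
      then show ?thesis using 2 x y XY by auto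
    qed
  qed
  have "(\<exists>v. unit_current_potential ?G x y v \<and> r = v x - v y) \<longleftrightarrow>
        (\<exists>v. unit_current_potential ?H x y v \<and> r = v x - v y)" for r
  proof
    assume "\<exists>v. unit_current_potential ?G x y v \<and> r = v x - v y"
    then show "\<exists>v. unit_current_potential ?H x y v \<and> r = v x - v y" using GH by blast
  next
    assume "\<exists>v. unit_current_potential ?H x y v \<and> r = v x - v y"
    then obtain v where "unit_current_potential ?H x y v" "r = v x - v y" by blast
    then show "\<exists>v. unit_current_potential ?G x y v \<and> r = v x - v y"
      using HG x y by (intro exI[of _ "\<lambda>u. if u \<in> X then v u else 0"]) simp
  qed
  then show ?thesis unfolding resistance_distance_def reach by simp
qed

lemma resistance_distance_across_components:
  assumes "A \<subseteq> X \<times> X" "B \<subseteq> Y \<times> Y" "X \<inter> Y = {}" "x \<in> X" "y \<in> Y"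
  shows "resistance_distance \<lparr>pverts = X \<union> Y, parcs = A \<union> B\<rparr> x y = \<infinity>"
  using reachable_stays_in_component[OF assms(1-3) _ assms(4), of y] assms(3,5)
  by (auto simp: resistance_distance_def)

lemma resistance_spectrum_disjoint_union:
  fixes X Y :: "nat set"
  assumes fin: "finite X" "finite Y" and A: "A \<subseteq> X \<times> X" and B: "B \<subseteq> Y \<times> Y" and XY: "X \<inter> Y = {}"
  shows "resistance_spectrum \<lparr>pverts = X \<union> Y, parcs = A \<union> B\<rparr> =
         resistance_spectrum \<lparr>pverts = X, parcs = A\<rparr> + resistance_spectrum \<lparr>pverts = Y, parcs = B\<rparr> +
         replicate_mset (card X * card Y) \<infinity>"
proof -
  let ?G = "\<lparr>pverts = X \<union> Y, parcs = A \<union> B\<rparr>"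
  let ?R = "\<lambda>(x, y). resistance_distance ?G x y"
  define P where "P V W = {(x, y). x \<in> V \<and> y \<in> W \<and> x < y}" for V W :: "nat set"
  have ne: "x \<noteq> y" if "x \<in> X" "y \<in> Y" for x y using that XY by auto
  have finP: "finite (P V W)" if "finite V" "finite W" for V W
    using that by (auto simp: P_def intro: rev_finite_subset[of "V \<times> W"])
  have YX: "Y \<inter> X = {}" using XY by auto
  have split: "P (X \<union> Y) (X \<union> Y) = (P X X \<union> P Y Y) \<union> (P X Y \<union> P Y X)"
    by (auto simp: P_def)
  have disj: "P X X \<inter> P Y Y = {}" "(P X X \<union> P Y Y) \<inter> (P X Y \<union> P Y X) = {}"
    using XY by (auto simp: P_def)
  have "mset_set (P (X \<union> Y) (X \<union> Y)) = mset_set (P X X) + mset_set (P Y Y) + mset_set (P X Y \<union> P Y X)"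
    unfolding split using XY
    by (simp add: mset_set_Union finP[OF fin(1) fin(1)] finP[OF fin(1) fin(2)]
        finP[OF fin(2) fin(1)] finP[OF fin(2) fin(2)] disj)
  moreover have "image_mset ?R (mset_set (P X X)) = resistance_spectrum \<lparr>pverts = X, parcs = A\<rparr>"
    unfolding resistance_spectrum_def P_def[symmetric] pair_pre_digraph.simps
    using finP[OF fin(1) fin(1)]
    by (intro image_mset_cong) (auto simp: P_def resistance_distance_within_component[OF A B XY])
  moreover have "image_mset ?R (mset_set (P Y Y)) = resistance_spectrum \<lparr>pverts = Y, parcs = B\<rparr>"
    unfolding resistance_spectrum_def P_def[symmetric] pair_pre_digraph.simps
    using finP[OF fin(2) fin(2)] resistance_distance_within_component[OF B A YX]
    by (intro image_mset_cong) (auto simp: P_def Un_commute)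
  moreover have "image_mset ?R (mset_set (P X Y \<union> P Y X)) = replicate_mset (card X * card Y) \<infinity>"
  proof -
    have "?R p = \<infinity>" if pP: "p \<in> P X Y \<union> P Y X" for p
    proof -
      obtain x y where p: "p = (x, y)" by fastforce
      consider "x \<in> X" "y \<in> Y" | "x \<in> Y" "y \<in> X"
        using pP by (auto simp: P_def p)
      then show ?thesis
      proof cases
        case 1
        then show ?thesis using resistance_distance_across_components[OF A B XY] by (simp add: p)
      next
        case 2
        then show ?thesis
          using resistance_distance_across_components[OF B A YX] by (simp add: p Un_commute)
      qed
    qed
    then have "image_mset ?R (mset_set (P X Y \<union> P Y X)) = image_mset (\<lambda>_. \<infinity>) (mset_set (P X Y \<union> P Y X))"
      using finP fin by (intro image_mset_cong) auto
    also have "\<dots> = replicate_mset (card (P X Y \<union> P Y X)) \<infinity>"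
      by (simp add: image_mset_const_eq)
    also have "card (P X Y \<union> P Y X) = card (X \<times> Y)"
    proof (rule bij_betw_same_card[of "\<lambda>(x, y). if x \<in> X then (x, y) else (y, x)"])
      show "bij_betw (\<lambda>(x, y). if x \<in> X then (x, y) else (y, x)) (P X Y \<union> P Y X) (X \<times> Y)"
        using XY by (intro bij_betw_byWitness[where f' = "\<lambda>(x, y). if x < y then (x, y) else (y, x)"])
          (auto simp: P_def dest: ne split: if_splits)
    qed
    finally show ?thesis by (simp add: card_cartesian_product)
  qed
  moreover have "resistance_spectrum ?G = image_mset ?R (mset_set (P (X \<union> Y) (X \<union> Y)))"
    by (simp only: resistance_spectrum_def P_def pair_pre_digraph.simps)
  ultimately show ?thesis by simp
qed

section \<open>Resistance distances from a table of potentials\<close>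

text \<open>
  Both sides expand to a sum over arcs, and reversing the arcs exchanges the roles of \<open>f\<close> and \<open>g\<close>.
\<close>

lemma laplacian_self_adjoint:
  fixes f g :: "'a \<Rightarrow> real"
  assumes "finite X" "A \<subseteq> X \<times> X" "sym A"
  shows "(\<Sum>u\<in>X. f u * (\<Sum>w | (u, w) \<in> A. g u - g w)) = (\<Sum>u\<in>X. g u * (\<Sum>w | (u, w) \<in> A. f u - f w))"
proof -
  have fin: "finite {w. (u, w) \<in> A}" for u
    using assms(1,2) by (auto intro: rev_finite_subset[of X])
  have edges: "(\<Sum>u\<in>X. h u * (\<Sum>w | (u, w) \<in> A. k u - k w)) = (\<Sum>(u, w)\<in>A. h u * k u) - (\<Sum>(u, w)\<in>A. h u * k w)"
    for h k :: "'a \<Rightarrow> real"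
  proof -
    have "(\<Sum>u\<in>X. h u * (\<Sum>w | (u, w) \<in> A. k u - k w)) = (\<Sum>u\<in>X. \<Sum>w | (u, w) \<in> A. h u * (k u - k w))"
      by (simp only: sum_distrib_left)
    also have "\<dots> = (\<Sum>(u, w)\<in>(SIGMA u:X. {w. (u, w) \<in> A}). h u * (k u - k w))"
      using assms(1) fin by (subst sum.Sigma) auto
    also have "(SIGMA u:X. {w. (u, w) \<in> A}) = A" using assms(2) by auto
    finally show ?thesis by (simp only: case_prod_unfold right_diff_distrib sum_subtractf)
  qed
  have "(\<Sum>(u, w)\<in>A. f u * g w) = (\<Sum>(u, w)\<in>A. g u * f w)"
    using assms(3)
    by (intro sum.reindex_bij_witness[of _ prod.swap prod.swap]) (auto dest: symD)
  then show ?thesis unfolding edges by (simp only: mult.commute)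
qed

text \<open>
  Pairing an arbitrary function \<open>f\<close> with the Laplacian of a unit current potential gives the drop of
  \<open>f\<close> from \<open>x\<close> to \<open>y\<close>. For two potentials, self-adjointness of the Laplacian makes the drops equal.
\<close>

lemma voltage_drop_unique:
  assumes "finite X" "A \<subseteq> X \<times> X" "sym A" "x \<in> X" "y \<in> X"
    and v: "unit_current_potential \<lparr>pverts = X, parcs = A\<rparr> x y v"
    and w: "unit_current_potential \<lparr>pverts = X, parcs = A\<rparr> x y w"
  shows "v x - v y = w x - w y"
proof -
  have drop: "(\<Sum>u\<in>X. f u * (\<Sum>w | (u, w) \<in> A. g u - g w)) = f x - f y"
    if "unit_current_potential \<lparr>pverts = X, parcs = A\<rparr> x y g" for f g
  proof -
    have "(\<Sum>u\<in>X. f u * (\<Sum>w | (u, w) \<in> A. g u - g w)) = (\<Sum>u\<in>X. f u * of_bool (u = x) - f u * of_bool (u = y))"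
      using that by (intro sum.cong) (auto simp: unit_current_potential_def)
    also have "\<dots> = f x - f y"
      using assms(1,4,5) by (simp add: sum_subtractf of_bool_def if_distrib[of "times _"] cong: if_cong)
    finally show ?thesis .
  qed
  show ?thesis
    using drop[OF v, of w] drop[OF w, of v] laplacian_self_adjoint[OF assms(1-3), of v w] by simp
qed

text \<open>
  Superposition: if \<open>g z\<close> is \<open>c\<close> times a potential for a unit current from \<open>z\<close> to the ground
  vertex \<open>r\<close>, then \<open>(g x - g y) / c\<close> is a potential for a unit current from \<open>x\<close> to \<open>y\<close>. So one table of
  grounded potentials yields all resistance distances.
\<close>

lemma resistance_distance_grounded:
  fixes g :: "'a \<Rightarrow> 'a \<Rightarrow> real"
  assumes "finite X" "A \<subseteq> X \<times> X" "sym A" "x \<in> X" "y \<in> X" "c \<noteq> 0"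
    and reach: "x \<rightarrow>\<^sup>*\<^bsub>with_proj \<lparr>pverts = X, parcs = A\<rparr>\<^esub> y"
    and g: "\<And>z u. z \<in> X \<Longrightarrow> u \<in> X \<Longrightarrow>
      (\<Sum>w | (u, w) \<in> A. g z u - g z w) = c * (of_bool (u = z) - of_bool (u = r))"
  shows "resistance_distance \<lparr>pverts = X, parcs = A\<rparr> x y = ereal ((g x x - g x y - g y x + g y y) / c)"
proof -
  let ?G = "\<lparr>pverts = X, parcs = A\<rparr>"
  define v where "v u = (g x u - g y u) / c" for u
  have v: "unit_current_potential ?G x y v"
    unfolding unit_current_potential_def
  proof
    fix u assume "u \<in> pverts ?G"
    then have u: "u \<in> X" by simp
    have "(\<Sum>w | (u, w) \<in> A. v u - v w) = ((\<Sum>w | (u, w) \<in> A. g x u - g x w) - (\<Sum>w | (u, w) \<in> A. g y u - g y w)) / c"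
      unfolding v_def sum_subtractf[symmetric] sum_divide_distrib
      by (rule sum.cong) (simp_all add: diff_divide_distrib)
    also have "\<dots> = of_bool (u = x) - of_bool (u = y)"
      using assms(6) by (simp add: g[OF assms(4) u] g[OF assms(5) u] field_simps)
    finally show "(\<Sum>w | (u, w) \<in> parcs ?G. v u - v w) = of_bool (u = x) - of_bool (u = y)" by simp
  qed
  have "(THE r. \<exists>v. unit_current_potential ?G x y v \<and> r = v x - v y) = v x - v y"
    using v voltage_drop_unique[OF assms(1-5) _ v] by (intro the_equality) blast+
  then show ?thesis using reach by (simp add: resistance_distance_def v_def diff_divide_distrib add_divide_distrib)
qed

section \<open>Five cospectral pairs of order nine\<close>

text \<open>
  A base graph is given by its list of edges on the vertices \<open>0, ..., 8\<close>, together with a table whose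
  entry \<open>M ! x ! u\<close> is a scaled potential at \<open>u\<close> when current flows from \<open>x\<close> to vertex \<open>0\<close>. All
  requirements on this data are phrased over lists, so that they can be verified by rewriting.
\<close>

type_synonym network = "(nat \<times> nat) list \<times> int list list"

definition edge_rel :: "(nat \<times> nat) list \<Rightarrow> nat rel" where
  "edge_rel es = set es \<union> (set es)\<inverse>"

definition neighbours :: "(nat \<times> nat) list \<Rightarrow> nat \<Rightarrow> nat list" where
  "neighbours es u = filter (\<lambda>w. (u, w) \<in> set es \<or> (w, u) \<in> set es) [0..<9]"

definition well_formed :: "(nat \<times> nat) list \<Rightarrow> bool" where
  "well_formed es \<longleftrightarrow> (\<forall>e\<in>set es. fst e < snd e \<and> snd e < 9)"

text \<open>
  The first conjunct gives each vertex other than \<open>0\<close> a smaller neighbour, which certifies that the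
  graph is connected. The factor \<open>c\<close> clears the denominators of the potentials.
\<close>

definition grounded_table :: "int \<Rightarrow> network \<Rightarrow> bool" where
  "grounded_table c N \<longleftrightarrow> (case N of (es, M) \<Rightarrow>
     (\<forall>x\<in>set [1..<9]. \<exists>w\<in>set [0..<x]. (w, x) \<in> set es) \<and>
     (\<forall>x\<in>set [0..<9]. \<forall>u\<in>set [0..<9].
        sum_list (map (\<lambda>w. M ! x ! u - M ! x ! w) (neighbours es u)) =
        c * (of_bool (u = x) - of_bool (u = 0))))"

definition vertex_pairs :: "(nat \<times> nat) list" where
  "vertex_pairs = filter (\<lambda>(x, y). x < y) (List.product [0..<9] [0..<9])"

definition scaled_resistances :: "int list list \<Rightarrow> int list" where
  "scaled_resistances M =
     map (\<lambda>(x, y). M ! x ! x - M ! x ! y - M ! y ! x + M ! y ! y) vertex_pairs"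

definition valencies :: "(nat \<times> nat) list \<Rightarrow> nat list" where
  "valencies es = map (\<lambda>u. length (neighbours es u)) [0..<9]"

text \<open>
  The last choice, \<open>d\<close>, is either at the end of a path \<open>v, b, c, d\<close> or at the start of a path
  \<open>d, v, b, c\<close>; in both cases the non-adjacent pairs are \<open>v, c\<close> and \<open>b, d\<close>.
\<close>

definition all_on_alternating_paths :: "(nat \<times> nat) list \<Rightarrow> bool" where
  "all_on_alternating_paths es \<longleftrightarrow> (\<forall>v\<in>set [0..<9].
     \<exists>b\<in>set (neighbours es v). \<exists>c\<in>set (neighbours es b). c \<noteq> v \<and> c \<notin> set (neighbours es v) \<and>
       (\<exists>d\<in>set (neighbours es c) \<union> set (neighbours es v). d \<noteq> b \<and> d \<notin> set (neighbours es b)))"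

lemma well_formedD: "well_formed es \<Longrightarrow> (u, w) \<in> set es \<Longrightarrow> u < w \<and> w < 9"
  unfolding well_formed_def by (drule bspec) auto

lemma edge_rel_subset: "well_formed es \<Longrightarrow> edge_rel es \<subseteq> {..<9} \<times> {..<9}"
  by (auto simp: edge_rel_def dest: well_formedD)

lemma sym_edge_rel: "sym (edge_rel es)"
  by (auto simp: edge_rel_def sym_def)

lemma edge_rel_irrefl: "well_formed es \<Longrightarrow> (u, u) \<notin> edge_rel es"
  by (auto simp: edge_rel_def dest: well_formedD)

lemma set_neighbours: "well_formed es \<Longrightarrow> set (neighbours es u) = {w. (u, w) \<in> edge_rel es}"
  using edge_rel_subset[of es] by (auto simp: neighbours_def edge_rel_def)

lemma sum_neighbours:
  assumes "well_formed es"
  shows "(\<Sum>w | (u, w) \<in> edge_rel es. f w) = sum_list (map f (neighbours es u))"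
  unfolding set_neighbours[OF assms, symmetric]
  by (rule sum.distinct_set_conv_list) (simp add: neighbours_def)

lemma valency_edge_rel:
  assumes "well_formed es"
  shows "card {w. (u, w) \<in> edge_rel es} = length (neighbours es u)"
  unfolding set_neighbours[OF assms, symmetric]
  by (rule distinct_card) (simp add: neighbours_def)

lemma network_connected:
  assumes wf: "well_formed es" and g: "grounded_table c (es, M)" and x: "x < 9" and y: "y < 9"
  shows "x \<rightarrow>\<^sup>*\<^bsub>with_proj \<lparr>pverts = {..<9}, parcs = edge_rel es\<rparr>\<^esub> y"
proof -
  let ?G = "\<lparr>pverts = {..<9::nat}, parcs = edge_rel es\<rparr>"
  have from0: "0 \<rightarrow>\<^sup>*\<^bsub>with_proj ?G\<^esub> z" if "z < 9" for z
    using that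
  proof (induction z rule: less_induct)
    case (less z)
    show ?case
    proof (cases "z = 0")
      case True
      then show ?thesis by (simp add: reachable_def)
    next
      case False
      then have "z \<in> set [1..<9]" using less.prems by simp
      then have "\<exists>w\<in>set [0..<z]. (w, z) \<in> set es"
        using g unfolding grounded_table_def by blast
      then obtain w where w: "w < z" "(w, z) \<in> set es" by auto
      then have "0 \<rightarrow>\<^sup>*\<^bsub>with_proj ?G\<^esub> w" using less by simp
      moreover have "(w, z) \<in> edge_rel es" using w by (simp add: edge_rel_def)
      ultimately show ?thesis
        using less.prems by (auto simp: reachable_def intro: rtrancl_on_into_rtrancl_on)
    qed
  qed
  have "symmetric (with_proj ?G)" using sym_edge_rel by (simp add: symmetric_def)
  then have "x \<rightarrow>\<^sup>*\<^bsub>with_proj ?G\<^esub> 0" using from0[OF x] by (rule symmetric_reachable)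
  from rtrancl_on_trans[OF this[unfolded reachable_def] from0[OF y, unfolded reachable_def]]
  show ?thesis by (simp only: reachable_def)
qed

lemma network_resistance:
  assumes wf: "well_formed es" and g: "grounded_table c (es, M)" and c: "c \<noteq> 0"
    and x: "x < 9" and y: "y < 9"
  shows "resistance_distance \<lparr>pverts = {..<9}, parcs = edge_rel es\<rparr> x y =
         ereal (of_int (M ! x ! x - M ! x ! y - M ! y ! x + M ! y ! y) / of_int c)"
proof -
  have "(\<Sum>w | (u, w) \<in> edge_rel es. real_of_int (M ! z ! u) - real_of_int (M ! z ! w)) =
        of_int c * (of_bool (u = z) - of_bool (u = 0))" if "z \<in> {..<9}" "u \<in> {..<9}" for z u
  proof -
    have "(\<Sum>w | (u, w) \<in> edge_rel es. real_of_int (M ! z ! u) - real_of_int (M ! z ! w)) =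
          of_int (\<Sum>w | (u, w) \<in> edge_rel es. M ! z ! u - M ! z ! w)"
      by simp
    also have "(\<Sum>w | (u, w) \<in> edge_rel es. M ! z ! u - M ! z ! w) = c * (of_bool (u = z) - of_bool (u = 0))"
      using g that by (simp add: sum_neighbours[OF wf] grounded_table_def)
    finally show ?thesis by simp
  qed
  then show ?thesis
    using resistance_distance_grounded[of "{..<9}" "edge_rel es" x y "of_int c" "\<lambda>z u. of_int (M ! z ! u)" 0]
      edge_rel_subset[OF wf] sym_edge_rel network_connected[OF wf g x y] x y c
    by simp
qed

lemma network_spectrum:
  assumes wf: "well_formed es" and g: "grounded_table c (es, M)" and c: "c \<noteq> 0"
  shows "resistance_spectrum \<lparr>pverts = {..<9}, parcs = edge_rel es\<rparr> =
         image_mset (\<lambda>k. ereal (of_int k / of_int c)) (mset (scaled_resistances M))"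
proof -
  let ?G = "\<lparr>pverts = {..<9::nat}, parcs = edge_rel es\<rparr>"
  have pairs: "set vertex_pairs = {(x, y). x \<in> pverts ?G \<and> y \<in> pverts ?G \<and> x < y}"
    unfolding vertex_pairs_def by (auto simp del: upt_rec_numeral)
  have "distinct vertex_pairs"
    unfolding vertex_pairs_def by (intro distinct_filter distinct_product distinct_upt)
  then have "mset_set {(x, y). x \<in> pverts ?G \<and> y \<in> pverts ?G \<and> x < y} = mset vertex_pairs"
    unfolding pairs[symmetric] by (rule mset_set_set)
  then have "resistance_spectrum ?G = mset (map (\<lambda>(x, y). resistance_distance ?G x y) vertex_pairs)"
    by (simp add: resistance_spectrum_def)
  also have "map (\<lambda>(x, y). resistance_distance ?G x y) vertex_pairs =
      map (\<lambda>k. ereal (of_int k / of_int c)) (scaled_resistances M)"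
    unfolding scaled_resistances_def map_map
  proof (rule map_cong[OF refl])
    fix p assume "p \<in> set vertex_pairs"
    then obtain x y where "p = (x, y)" "x < 9" "y < 9" using pairs by auto
    then show "(\<lambda>(x, y). resistance_distance ?G x y) p =
        ((\<lambda>k. ereal (of_int k / of_int c)) \<circ> (\<lambda>(x, y). M ! x ! x - M ! x ! y - M ! y ! x + M ! y ! y)) p"
      using network_resistance[OF assms] by simp
  qed
  finally show ?thesis by simp
qed

text \<open>
  The pairs come from an enumeration of connected graphs of order nine with few edges: two pairs of
  trees and one pair each with nine, ten and eleven edges. The scale \<open>c\<close> is the same for
  both graphs of a pair, so that their scaled resistances can be compared as integers.
\<close>

definition base_pairs :: "(int \<times> network \<times> network) list" where
  "base_pairs = [
    (1,
      ([(0,1), (0,2), (0,3), (0,4), (0,5), (1,6), (2,7), (3,8)],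
       [[0,0,0,0,0,0,0,0,0],
        [0,1,0,0,0,0,1,0,0],
        [0,0,1,0,0,0,0,1,0],
        [0,0,0,1,0,0,0,0,1],
        [0,0,0,0,1,0,0,0,0],
        [0,0,0,0,0,1,0,0,0],
        [0,1,0,0,0,0,2,0,0],
        [0,0,1,0,0,0,0,2,0],
        [0,0,0,1,0,0,0,0,2]]),
      ([(0,1), (0,2), (0,3), (0,4), (1,5), (1,6), (1,7), (2,8)],
       [[0,0,0,0,0,0,0,0,0],
        [0,1,0,0,0,1,1,1,0],
        [0,0,1,0,0,0,0,0,1],
        [0,0,0,1,0,0,0,0,0],
        [0,0,0,0,1,0,0,0,0],
        [0,1,0,0,0,2,1,1,0],
        [0,1,0,0,0,1,2,1,0],
        [0,1,0,0,0,1,1,2,0],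
        [0,0,1,0,0,0,0,0,2]])),
    (1,
      ([(0,1), (0,2), (0,3), (0,4), (1,5), (2,6), (3,7), (5,8)],
       [[0,0,0,0,0,0,0,0,0],
        [0,1,0,0,0,1,0,0,1],
        [0,0,1,0,0,0,1,0,0],
        [0,0,0,1,0,0,0,1,0],
        [0,0,0,0,1,0,0,0,0],
        [0,1,0,0,0,2,0,0,2],
        [0,0,1,0,0,0,2,0,0],
        [0,0,0,1,0,0,0,2,0],
        [0,1,0,0,0,2,0,0,3]]),
      ([(0,1), (0,2), (0,3), (1,4), (1,5), (2,6), (2,7), (4,8)],
       [[0,0,0,0,0,0,0,0,0],
        [0,1,0,0,1,1,0,0,1],
        [0,0,1,0,0,0,1,1,0],
        [0,0,0,1,0,0,0,0,0],
        [0,1,0,0,2,1,0,0,2],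
        [0,1,0,0,1,2,0,0,1],
        [0,0,1,0,0,0,2,1,0],
        [0,0,1,0,0,0,1,2,0],
        [0,1,0,0,2,1,0,0,3]])),
    (4,
      ([(0,1), (0,2), (0,3), (0,4), (1,5), (2,6), (3,7), (4,6), (5,8)],
       [[0,0,0,0,0,0,0,0,0],
        [0,4,0,0,0,4,0,0,4],
        [0,0,3,0,1,0,2,0,0],
        [0,0,0,4,0,0,0,4,0],
        [0,0,1,0,3,0,2,0,0],
        [0,4,0,0,0,8,0,0,8],
        [0,0,2,0,2,0,4,0,0],
        [0,0,0,4,0,0,0,8,0],
        [0,4,0,0,0,8,0,0,12]]),
      ([(0,1), (0,2), (0,3), (1,4), (1,5), (2,6), (3,6), (4,7), (6,8)],
       [[0,0,0,0,0,0,0,0,0],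
        [0,4,0,0,4,4,0,4,0],
        [0,0,3,1,0,0,2,0,2],
        [0,0,1,3,0,0,2,0,2],
        [0,4,0,0,8,4,0,8,0],
        [0,4,0,0,4,8,0,4,0],
        [0,0,2,2,0,0,4,0,4],
        [0,4,0,0,8,4,0,12,0],
        [0,0,2,2,0,0,4,0,8]])),
    (4,
      ([(0,1), (0,2), (0,3), (0,4), (0,5), (1,6), (2,7), (3,8), (4,6), (5,7)],
       [[0,0,0,0,0,0,0,0,0],
        [0,3,0,0,1,0,2,0,0],
        [0,0,3,0,0,1,0,2,0],
        [0,0,0,4,0,0,0,0,4],
        [0,1,0,0,3,0,2,0,0],
        [0,0,1,0,0,3,0,2,0],
        [0,2,0,0,2,0,4,0,0],
        [0,0,2,0,0,2,0,4,0],
        [0,0,0,4,0,0,0,0,8]]),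
      ([(0,1), (0,2), (0,3), (0,4), (1,5), (2,6), (3,5), (4,6), (5,7), (5,8)],
       [[0,0,0,0,0,0,0,0,0],
        [0,3,0,1,0,2,0,2,2],
        [0,0,3,0,1,0,2,0,0],
        [0,1,0,3,0,2,0,2,2],
        [0,0,1,0,3,0,2,0,0],
        [0,2,0,2,0,4,0,4,4],
        [0,0,2,0,2,0,4,0,0],
        [0,2,0,2,0,4,0,8,4],
        [0,2,0,2,0,4,0,4,8]])),
    (6,
      ([(0,1), (0,2), (0,3), (0,4), (0,5), (1,6), (1,7), (2,3), (2,8), (4,6), (4,7)],
       [[0,0,0,0,0,0,0,0,0],
        [0,4,0,0,2,0,3,3,0],
        [0,0,4,2,0,0,0,0,4],
        [0,0,2,4,0,0,0,0,2],
        [0,2,0,0,4,0,3,3,0],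
        [0,0,0,0,0,6,0,0,0],
        [0,3,0,0,3,0,6,3,0],
        [0,3,0,0,3,0,3,6,0],
        [0,0,4,2,0,0,0,0,10]]),
      ([(0,1), (0,2), (0,3), (0,4), (1,5), (1,6), (1,7), (2,5), (2,8), (3,5), (6,7)],
       [[0,0,0,0,0,0,0,0,0],
        [0,4,1,1,0,2,4,4,1],
        [0,1,4,1,0,2,1,1,4],
        [0,1,1,4,0,2,1,1,1],
        [0,0,0,0,6,0,0,0,0],
        [0,2,2,2,0,4,2,2,2],
        [0,4,1,1,0,2,8,6,1],
        [0,4,1,1,0,2,6,8,1],
        [0,1,4,1,0,2,1,1,10]]))]"

lemma base_pairs_well_formed:
  "\<forall>(c, A, B)\<in>set base_pairs. c \<noteq> 0 \<and> well_formed (fst A) \<and> well_formed (fst B)"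
  by code_simp

lemma base_pairs_grounded:
  "\<forall>(c, A, B)\<in>set base_pairs. grounded_table c A \<and> grounded_table c B"
  by code_simp

lemma base_pairs_alternating:
  "\<forall>(c, A, B)\<in>set base_pairs. all_on_alternating_paths (fst A) \<and> all_on_alternating_paths (fst B)"
  by code_simp

lemma base_pairs_cospectral:
  "\<forall>(c, A, B)\<in>set base_pairs. sort (scaled_resistances (snd A)) = sort (scaled_resistances (snd B))"
  by code_simp

lemma base_pairs_valencies:
  "map (\<lambda>(c, A, B). (sort (valencies (fst A)), sort (valencies (fst B)))) base_pairs =
    [([1,1,1,1,1,2,2,2,5], [1,1,1,1,1,1,2,4,4]),
     ([1,1,1,1,2,2,2,2,4], [1,1,1,1,1,2,3,3,3]),
     ([1,1,2,2,2,2,2,2,4], [1,1,1,2,2,2,3,3,3]),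
     ([1,2,2,2,2,2,2,2,5], [1,1,2,2,2,2,2,4,4]),
     ([1,1,2,2,2,3,3,3,5], [1,1,2,2,2,3,3,4,4])]"
  by code_simp

definition first_graph :: "nat \<Rightarrow> (nat \<times> nat) list" where
  "first_graph i = fst (fst (snd (base_pairs ! i)))"

definition second_graph :: "nat \<Rightarrow> (nat \<times> nat) list" where
  "second_graph i = fst (snd (snd (base_pairs ! i)))"

section \<open>Threshold graphs\<close>

text \<open>
  The elements of \<open>S\<close> are the vertices that are joined to all smaller ones; the others are joined
  to none of them.
\<close>

definition threshold_arcs :: "nat set \<Rightarrow> nat set \<Rightarrow> nat rel" where
  "threshold_arcs V S = {(i, j). i \<in> V \<and> j \<in> V \<and> i \<noteq> j \<and> max i j \<in> S}"

text \<open>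
  The largest of \<open>a, b, c, d\<close> has a smaller neighbour on the path, so it is adjacent to all
  the others, including the one at distance two along the path.
\<close>

lemma threshold_no_alternating_path:
  assumes "(a, b) \<in> threshold_arcs V S" "(b, c) \<in> threshold_arcs V S" "(c, d) \<in> threshold_arcs V S"
    and "a \<noteq> c" "b \<noteq> d"
  shows "(a, c) \<in> threshold_arcs V S \<or> (b, d) \<in> threshold_arcs V S"
  using assms by (auto simp: threshold_arcs_def max_def split: if_splits)

definition threshold_valencies :: "nat \<Rightarrow> nat \<Rightarrow> nat set \<Rightarrow> nat multiset" where
  "threshold_valencies a n S =
     image_mset (\<lambda>v. card {w. (v, w) \<in> threshold_arcs {a..<n} S}) (mset_set {a..<n})"

lemma threshold_valencies_Suc:
  assumes "a \<le> n"
  shows "threshold_valencies a (Suc n) S =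
    (if n \<in> S then add_mset (n - a) (image_mset Suc (threshold_valencies a n S))
     else add_mset 0 (threshold_valencies a n S))"
proof -
  let ?N = "\<lambda>k v. {w. (v, w) \<in> threshold_arcs {a..<k} S}"
  have V: "{a..<Suc n} = insert n {a..<n}" using assms by auto
  have top: "?N (Suc n) n = (if n \<in> S then {a..<n} else {})"
    using assms by (auto simp: threshold_arcs_def max_def)
  have fin: "finite (?N n v)" for v
    by (rule finite_subset[of _ "{a..<n}"]) (auto simp: threshold_arcs_def)
  have old: "card (?N (Suc n) v) = (if n \<in> S then Suc (card (?N n v)) else card (?N n v))"
    if "v \<in> {a..<n}" for v
  proof -
    have "?N (Suc n) v = (if n \<in> S then insert n (?N n v) else ?N n v)"
      using that by (auto simp: threshold_arcs_def max_def less_Suc_eq split: if_splits)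
    moreover have "n \<notin> ?N n v" by (simp add: threshold_arcs_def)
    ultimately show ?thesis using fin by simp
  qed
  have "threshold_valencies a (Suc n) S = add_mset (card (?N (Suc n) n))
      (image_mset (\<lambda>v. card (?N (Suc n) v)) (mset_set {a..<n}))"
    unfolding threshold_valencies_def V by simp
  also have "image_mset (\<lambda>v. card (?N (Suc n) v)) (mset_set {a..<n}) =
      image_mset (\<lambda>v. if n \<in> S then Suc (card (?N n v)) else card (?N n v)) (mset_set {a..<n})"
    by (intro image_mset_cong) (simp only: old elem_mset_set finite_atLeastLessThan)
  finally show ?thesis
    by (simp add: top threshold_valencies_def multiset.map_comp comp_def)
qed

text \<open>
  Reading \<open>S\<close> off from the top: the last vertex was joined to its predecessors if and only if no vertex
  is isolated, and in either case its contribution can be undone. The smallest vertex \<open>a\<close> has no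
  predecessors, so whether it belongs to \<open>S\<close> is invisible.
\<close>

lemma threshold_valencies_inject:
  "threshold_valencies a n S = threshold_valencies a n T \<Longrightarrow> S \<inter> {a<..<n} = T \<inter> {a<..<n}"
proof (induction n)
  case 0
  then show ?case by simp
next
  case (Suc n)
  show ?case
  proof (cases "a < n")
    case False
    then have "{a<..<Suc n} = {}" by auto
    then show ?thesis by simp
  next
    case True
    have isolated: "0 \<in># threshold_valencies a (Suc n) U \<longleftrightarrow> n \<notin> U" for U
      using True by (auto simp: threshold_valencies_Suc)
    have top: "n \<in> S \<longleftrightarrow> n \<in> T" using isolated[of S] isolated[of T] Suc.prems by simp
    have "threshold_valencies a n S = threshold_valencies a n T"
    proof (cases "n \<in> S")
      case in_S: True
      have "image_mset Suc (threshold_valencies a n S) = image_mset Suc (threshold_valencies a n T)"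
        using Suc.prems True in_S top by (simp add: threshold_valencies_Suc)
      then show ?thesis using multiset.inj_map[OF inj_Suc] by (rule injD[rotated])
    next
      case False
      then show ?thesis using Suc.prems True top by (simp add: threshold_valencies_Suc)
    qed
    then have "S \<inter> {a<..<n} = T \<inter> {a<..<n}" by (rule Suc.IH)
    moreover have "{a<..<Suc n} = insert n {a<..<n}" using True by auto
    ultimately show ?thesis using top by auto
  qed
qed

section \<open>Adding a threshold graph to a graph of order nine\<close>

definition padded :: "nat \<Rightarrow> (nat \<times> nat) list \<Rightarrow> nat set \<Rightarrow> nat pair_pre_digraph" where
  "padded n es S = \<lparr>pverts = {..<9} \<union> {9..<n}, parcs = edge_rel es \<union> threshold_arcs {9..<n} S\<rparr>"

lemma threshold_arcs_subset: "threshold_arcs V S \<subseteq> V \<times> V"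
  by (auto simp: threshold_arcs_def)

lemma padded_in_graphs_of_order:
  assumes wf: "well_formed es" and n: "9 \<le> n"
  shows "padded n es S \<in> graphs_of_order n"
proof -
  have V: "{..<9} \<union> {9..<n} = {..<n}" using n by auto
  have arcs: "edge_rel es \<union> threshold_arcs {9..<n} S \<subseteq> {..<n} \<times> {..<n}"
    using edge_rel_subset[OF wf] threshold_arcs_subset[of "{9..<n}" S] n by force
  have "pair_graph (padded n es S)"
  proof
    show "finite (parcs (padded n es S))"
      using arcs by (auto simp: padded_def intro: rev_finite_subset)
    show "symmetric (with_proj (padded n es S))"
      using sym_edge_rel[of es]
      by (auto simp: padded_def symmetric_def sym_def threshold_arcs_def max.commute)
  qed (use arcs edge_rel_irrefl[OF wf] in \<open>auto simp: padded_def V threshold_arcs_def\<close>)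
  then show ?thesis by (simp add: graphs_of_order_def padded_def V)
qed

lemma padded_spectrum_eq:
  assumes "well_formed es" "well_formed fs"
    and "resistance_spectrum \<lparr>pverts = {..<9}, parcs = edge_rel es\<rparr> =
         resistance_spectrum \<lparr>pverts = {..<9}, parcs = edge_rel fs\<rparr>"
  shows "resistance_spectrum (padded n es S) = resistance_spectrum (padded n fs S)"
proof -
  let ?F = "\<lparr>pverts = {9..<n}, parcs = threshold_arcs {9..<n} S\<rparr>"
  have "resistance_spectrum (padded n gs S) =
      resistance_spectrum \<lparr>pverts = {..<9}, parcs = edge_rel gs\<rparr> + resistance_spectrum ?F +
      replicate_mset (card {..<9::nat} * card {9..<n}) \<infinity>" if "well_formed gs" for gs
    unfolding padded_def
    by (rule resistance_spectrum_disjoint_union[OF _ _ edge_rel_subset[OF that] threshold_arcs_subset]) auto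
  then show ?thesis by (simp only: assms)
qed

text \<open>
  A path that meets \<open>{9..<n}\<close> stays there, so it is not alternating.
\<close>

lemma padded_profile:
  assumes wf: "well_formed es" and alt: "all_on_alternating_paths es"
  shows "profile (padded n es S) = image_mset (Pair True) (mset (valencies es)) +
           image_mset (Pair False) (threshold_valencies 9 n S)"
proof -
  let ?G = "padded n es S" and ?T = "threshold_arcs {9..<n} S"
  have low: "(u, w) \<in> parcs ?G \<longleftrightarrow> (u, w) \<in> edge_rel es" if "u < 9" for u w
    using that by (auto simp: padded_def threshold_arcs_def)
  have high: "(u, w) \<in> parcs ?G \<longleftrightarrow> (u, w) \<in> ?T" if "\<not> u < 9" for u w
    using that edge_rel_subset[OF wf] by (auto simp: padded_def)
  have low': "w < 9" if "(u, w) \<in> edge_rel es" for u w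
    using that edge_rel_subset[OF wf] by auto
  have on: "on_alternating_path ?G v" if v: "v < 9" for v
  proof -
    have "v \<in> set [0..<9]" using v by simp
    from bspec[OF alt[unfolded all_on_alternating_paths_def set_neighbours[OF wf]] this]
    obtain b c d where p: "(v, b) \<in> edge_rel es" "(b, c) \<in> edge_rel es" "c \<noteq> v" "(v, c) \<notin> edge_rel es"
      "(c, d) \<in> edge_rel es \<or> (v, d) \<in> edge_rel es" "d \<noteq> b" "(b, d) \<notin> edge_rel es"
      by auto
    have lt: "b < 9" "c < 9" "d < 9" using p low' by blast+
    have sym: "(x, y) \<in> edge_rel es \<longleftrightarrow> (y, x) \<in> edge_rel es" for x y
      using sym_edge_rel[of es] by (auto dest: symD)
    show ?thesis
    proof (cases "(c, d) \<in> edge_rel es")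
      case True
      then show ?thesis unfolding on_alternating_path_def using p lt v low
        by (intro exI[of _ v] exI[of _ b] exI[of _ c] exI[of _ d]) auto
    next
      case False
      then show ?thesis unfolding on_alternating_path_def using p lt v low sym
        by (intro exI[of _ d] exI[of _ v] exI[of _ b] exI[of _ c]) auto
    qed
  qed
  have off: "\<not> on_alternating_path ?G v" if v: "\<not> v < 9" for v
  proof
    assume "on_alternating_path ?G v"
    then obtain a b c d where p: "(a, b) \<in> parcs ?G" "(b, c) \<in> parcs ?G" "(c, d) \<in> parcs ?G"
      "a \<noteq> c" "(a, c) \<notin> parcs ?G" "b \<noteq> d" "(b, d) \<notin> parcs ?G" "v \<in> {a, b}"
      by (auto simp: on_alternating_path_def)
    have ge: "\<not> a < 9" "\<not> b < 9" "\<not> c < 9"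
      using p v low low' high by (auto simp: threshold_arcs_def)
    show False
      using threshold_no_alternating_path[of a b "{9..<n}" S c d] p ge high by blast
  qed
  have "profile ?G = image_mset (\<lambda>v. (on_alternating_path ?G v, valency ?G v)) (mset_set {..<9}) +
      image_mset (\<lambda>v. (on_alternating_path ?G v, valency ?G v)) (mset_set {9..<n})"
    unfolding profile_def by (simp add: padded_def mset_set_Union ivl_disj_int)
  also have "image_mset (\<lambda>v. (on_alternating_path ?G v, valency ?G v)) (mset_set {..<9}) =
      image_mset (\<lambda>v. (True, length (neighbours es v))) (mset_set {..<9})"
    using on low by (intro image_mset_cong) (simp add: valency_def valency_edge_rel[OF wf])
  also have "\<dots> = image_mset (Pair True) (mset (valencies es))"
    by (simp add: valencies_def multiset.map_comp comp_def lessThan_atLeast0 mset_upt del: upt_rec_numeral)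
  also have "image_mset (\<lambda>v. (on_alternating_path ?G v, valency ?G v)) (mset_set {9..<n}) =
      image_mset (Pair False) (threshold_valencies 9 n S)"
    unfolding threshold_valencies_def multiset.map_comp comp_def
    using off high by (intro image_mset_cong) (simp add: valency_def)
  finally show ?thesis .
qed

lemma padded_profile_inject:
  assumes "well_formed es" "all_on_alternating_paths es" "well_formed fs" "all_on_alternating_paths fs"
    and "S \<subseteq> {10..<n}" "T \<subseteq> {10..<n}"
    and eq: "profile (padded n es S) = profile (padded n fs T)"
  shows "sort (valencies es) = sort (valencies fs) \<and> S = T"
proof -
  have *: "image_mset snd (filter_mset fst (profile (padded n es S))) = image_mset snd (filter_mset fst (profile (padded n fs T)))"
   "image_mset snd (filter_mset (Not \<circ> fst) (profile (padded n es S))) = image_mset snd (filter_mset (Not \<circ> fst) (profile (padded n fs T)))"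
    using eq by simp_all
  have "mset (valencies es) = mset (valencies fs)"
    and val: "threshold_valencies 9 n S = threshold_valencies 9 n T"
    using * assms(1-4)
    by (simp_all add: padded_profile filter_mset_image_mset multiset.map_comp comp_def)
  moreover have "{9<..<n} = {10..<n}" by auto
  moreover have "S \<inter> {9<..<n} = T \<inter> {9<..<n}" using threshold_valencies_inject[OF val] .
  ultimately show ?thesis using assms(5,6) by (metis inf.absorb1 sorted_list_of_multiset_mset)
qed

section \<open>A bound on the number of partitions\<close>

definition partitions :: "nat \<Rightarrow> nat multiset set" where
  "partitions t = {P. 0 \<notin># P \<and> \<Sum>\<^sub># P = t}"

lemma num_partitions_eq_card: "num_partitions t = card (partitions t)"
  by (simp add: num_partitions_def partitions_def)

lemma partitions_0: "partitions 0 = {{#}}"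
proof -
  have "P = {#}" if "0 \<notin># P" "\<Sum>\<^sub># P = 0" for P :: "nat multiset"
    using that by (cases P) auto
  then show ?thesis by (auto simp: partitions_def)
qed

lemma partitions_1: "partitions 1 = {{#1#}}"
proof -
  have "P = {#1#}" if P: "0 \<notin># P" "\<Sum>\<^sub># P = 1" for P :: "nat multiset"
  proof -
    have "P \<noteq> {#}" using P(2) by auto
    then obtain m Q where PQ: "P = add_mset m Q" by (meson multiset_cases)
    have "m \<noteq> 0" "0 \<notin># Q" "m + \<Sum>\<^sub># Q = 1" using P by (auto simp: PQ)
    then have "m = 1" "\<Sum>\<^sub># Q = 0" by linarith+
    moreover have "Q \<in> partitions 0"
      unfolding partitions_def using \<open>0 \<notin># Q\<close> \<open>\<Sum>\<^sub># Q = 0\<close> by blast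
    ultimately show ?thesis by (simp add: PQ partitions_0)
  qed
  then show ?thesis by (auto simp: partitions_def)
qed

text \<open>
  Partitions of \<open>t + 2\<close> with a part \<open>1\<close> arise from partitions of \<open>t + 1\<close>. In a partition without
  a part \<open>1\<close>, break the largest part \<open>m\<close> into \<open>m - 2\<close> ones, discarding two units. This gives a
  partition of \<open>t\<close> whose ones are all new, so their number reveals \<open>m\<close>.
\<close>

lemma card_partitions_add_2:
  assumes "finite (partitions t)" "finite (partitions (Suc t))"
  shows "finite (partitions (Suc (Suc t))) \<and>
    card (partitions (Suc (Suc t))) \<le> card (partitions (Suc t)) + card (partitions t)"
proof -
  let ?W = "{P \<in> partitions (Suc (Suc t)). 1 \<in># P}"
  let ?N = "{P \<in> partitions (Suc (Suc t)). 1 \<notin># P}"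
  have W_inj: "inj_on (\<lambda>P. P - {#1#}) ?W"
    by (rule inj_onI) (metis (mono_tags, lifting) insert_DiffM mem_Collect_eq)
  have W_sub: "(\<lambda>P. P - {#1#}) ` ?W \<subseteq> partitions (Suc t)"
  proof
    fix Q assume "Q \<in> (\<lambda>P. P - {#1#}) ` ?W"
    then obtain P where P: "P \<in> partitions (Suc (Suc t))" "1 \<in># P" "Q = P - {#1#}" by auto
    then have "P = add_mset 1 Q" by simp
    then show "Q \<in> partitions (Suc t)" using P(1) by (auto simp: partitions_def)
  qed
  define shave :: "nat multiset \<Rightarrow> nat multiset"
    where "shave P = (P - {#Max_mset P#}) + replicate_mset (Max_mset P - 2) 1" for P
  have big: "Max_mset P \<in># P \<and> 2 \<le> Max_mset P" if "P \<in> ?N" for P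
  proof -
    have "P \<noteq> {#}" using that by (auto simp: partitions_def)
    then have M: "Max_mset P \<in># P" by simp
    moreover have "0 \<notin># P" "1 \<notin># P" using that by (auto simp: partitions_def)
    ultimately have "Max_mset P \<noteq> 0" "Max_mset P \<noteq> 1" by metis+
    then show ?thesis using M by auto
  qed
  have N_inj: "inj_on shave ?N"
  proof (rule inj_onI)
    have restore: "P = add_mset (count (shave P) 1 + 2) (filter_mset (\<lambda>k. k \<noteq> 1) (shave P))"
      if P: "P \<in> ?N" for P
    proof -
      have "count (P - {#Max_mset P#}) 1 = 0" using P by (simp add: not_in_iff)
      then have "count (shave P) 1 = Max_mset P - 2" by (simp add: shave_def)
      then have "count (shave P) 1 + 2 = Max_mset P" using conjunct2[OF big[OF P]] by linarith
      moreover have "filter_mset (\<lambda>k. k \<noteq> 1) (shave P) = P - {#Max_mset P#}"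
      proof -
        have "filter_mset (\<lambda>k. k \<noteq> 1) (P - {#Max_mset P#}) = P - {#Max_mset P#}"
          using P by (intro filter_mset_eq_conv[THEN iffD2]) (auto dest: in_diffD)
        then show ?thesis by (simp add: shave_def)
      qed
      ultimately show ?thesis using big[OF P] by simp
    qed
    fix P Q assume PQ: "P \<in> ?N" "Q \<in> ?N" and eq: "shave P = shave Q"
    show "P = Q"
      by (subst restore[OF PQ(1)], subst restore[OF PQ(2)]) (simp only: eq)
  qed
  have N_sub: "shave ` ?N \<subseteq> partitions t"
  proof
    fix Q assume "Q \<in> shave ` ?N"
    then obtain P where P: "P \<in> ?N" "Q = shave P" by auto
    define R where "R = P - {#Max_mset P#}"
    have PR: "P = add_mset (Max_mset P) R" using big[OF P(1)] by (simp add: R_def)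
    have "\<Sum>\<^sub># P = Suc (Suc t)" "0 \<notin># P" using P(1) by (auto simp: partitions_def)
    then have "Max_mset P + \<Sum>\<^sub># R = Suc (Suc t)" "0 \<notin># R"
      using arg_cong[OF PR, of sum_mset] by (auto simp: R_def dest: in_diffD)
    moreover have "Q = R + replicate_mset (Max_mset P - 2) 1" by (simp add: P(2) shave_def R_def)
    ultimately show "Q \<in> partitions t"
      using big[OF P(1)] by (auto simp: partitions_def sum_mset_replicate_mset)
  qed
  have split: "partitions (Suc (Suc t)) = ?W \<union> ?N" by auto
  have "finite ?W" "finite ?N"
    using inj_on_finite[OF W_inj W_sub assms(2)] inj_on_finite[OF N_inj N_sub assms(1)] by auto
  moreover have "card ?W \<le> card (partitions (Suc t))" "card ?N \<le> card (partitions t)"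
    using card_inj_on_le[OF W_inj W_sub assms(2)] card_inj_on_le[OF N_inj N_sub assms(1)] by auto
  moreover have "card (partitions (Suc (Suc t))) \<le> card ?W + card ?N"
    by (subst split) (rule card_Un_le)
  ultimately show ?thesis using split by (metis (no_types, lifting) add_mono finite_Un le_trans)
qed

lemma finite_partitions: "finite (partitions t) \<and> finite (partitions (Suc t))"
  using partitions_1 by (induction t) (simp_all add: partitions_0 card_partitions_add_2)

lemma num_partitions_add_2:
  "num_partitions (Suc (Suc t)) \<le> num_partitions (Suc t) + num_partitions t"
  using card_partitions_add_2 finite_partitions by (simp add: num_partitions_eq_card)

text \<open>
  With the Fibonacci bounds \<open>2, 3, 5, 8\<close> for \<open>p 2, ..., p 5\<close>, equality would hold at \<open>t = 4\<close> and
  \<open>t = 5\<close>; this is why five base pairs are used. Beyond that the recursion suffices.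
\<close>

lemma num_partitions_exponential_bound: "4 * t * num_partitions t \<le> 5 * 2 ^ t"
proof -
  let ?p = num_partitions
  have p0: "?p 0 = 1" and p1: "?p 1 = 1"
    by (simp_all only: num_partitions_eq_card partitions_0 partitions_1) simp_all
  have p2: "?p 2 \<le> 2" using num_partitions_add_2[of 0] p0 p1 by (simp add: numeral_2_eq_2)
  have p3: "?p 3 \<le> 3" using num_partitions_add_2[of 1] p1 p2 by (simp add: numeral_eq_Suc)
  have p4: "?p 4 \<le> 5" using num_partitions_add_2[of 2] p2 p3 by (simp add: numeral_eq_Suc)
  have p5: "?p 5 \<le> 8" using num_partitions_add_2[of 3] p3 p4 by (simp add: numeral_eq_Suc)
  have large: "4 * t * ?p t \<le> 5 * 2 ^ t \<and> 4 * Suc t * ?p (Suc t) \<le> 5 * 2 ^ Suc t" if "4 \<le> t" for t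
    using that
  proof (induction t rule: dec_induct)
    case base
    then show ?case using p4 p5 by (simp add: eval_nat_numeral)
  next
    case (step t)
    \<comment> \<open>Multiplying by \<open>t * (t + 1)\<close> avoids fractions; the claim reduces to
      \<open>2 * t * (t + 2) + (t + 1) * (t + 2) \<le> 4 * t * (t + 1)\<close>, which needs \<open>t \<ge> 4\<close>.\<close>
    have "4 * (Suc t * ?p (Suc t)) \<le> 5 * 2 ^ Suc t"
      using step.IH by (simp only: mult.assoc)
    then have IH: "4 * (t * ?p t) \<le> 5 * 2 ^ t" "4 * (Suc t * ?p (Suc t)) \<le> 10 * 2 ^ t"
      using step.IH by (auto simp only: mult.assoc power_Suc)
    have "t * Suc t * (4 * ((t + 2) * ?p (Suc (Suc t)))) \<le>
          t * Suc t * (4 * ((t + 2) * (?p (Suc t) + ?p t)))"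
      using num_partitions_add_2[of t] by (intro mult_le_mono) auto
    also have "\<dots> = t * (t + 2) * (4 * (Suc t * ?p (Suc t))) + Suc t * (t + 2) * (4 * (t * ?p t))"
      by (simp add: algebra_simps)
    also have "\<dots> \<le> t * (t + 2) * (10 * 2 ^ t) + Suc t * (t + 2) * (5 * 2 ^ t)"
      by (intro add_mono mult_le_mono2 IH)
    also have "\<dots> = (2 * (t * (t + 2)) + Suc t * (t + 2)) * (5 * 2 ^ t)"
      by (simp add: algebra_simps)
    also have "\<dots> \<le> (4 * (t * Suc t)) * (5 * 2 ^ t)"
    proof (intro mult_le_mono)
      obtain s where "t = 4 + s" using step.hyps(1) le_Suc_ex by blast
      then show "2 * (t * (t + 2)) + Suc t * (t + 2) \<le> 4 * (t * Suc t)"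
        by (simp add: algebra_simps)
    qed simp_all
    also have "\<dots> = t * Suc t * (5 * 2 ^ Suc (Suc t))" by (simp add: algebra_simps)
    finally have "4 * ((t + 2) * ?p (Suc (Suc t))) \<le> 5 * 2 ^ Suc (Suc t)"
      using step.hyps(1) by (simp only: mult_le_cancel1) auto
    then have "4 * Suc (Suc t) * ?p (Suc (Suc t)) \<le> 5 * 2 ^ Suc (Suc t)"
      by (simp only: mult.assoc add_2_eq_Suc')
    then show ?case using step.IH by blast
  qed
  consider "t = 0" | "t = 1" | "t = 2" | "t = 3" | "4 \<le> t" by linarith
  then show ?thesis
  proof cases
    case 5
    then show ?thesis using large by blast
  qed (use p1 p2 p3 in auto)
qed

section \<open>Counting cospectral pairs\<close>

lemma finite_graphs_of_order: "finite (graphs_of_order n)"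
proof (rule finite_imageD)
  show "finite (parcs ` graphs_of_order n)"
  proof (rule finite_subset)
    show "parcs ` graphs_of_order n \<subseteq> Pow ({..<n} \<times> {..<n})"
    proof clarify
      fix G and u v :: nat
      assume G: "G \<in> graphs_of_order n" and uv: "(u, v) \<in> parcs G"
      interpret pair_graph G using G by (simp add: graphs_of_order_def)
      show "u \<in> {..<n} \<and> v \<in> {..<n}" using wellformed'[OF uv] G by (simp add: graphs_of_order_def)
    qed
  qed simp
  show "inj_on parcs (graphs_of_order n)"
    by (rule inj_onI) (simp add: graphs_of_order_def)
qed

lemma finite_cospectral_pairs: "finite (cospectral_pairs n)"
proof (rule finite_subset)
  show "cospectral_pairs n \<subseteq>
      (\<lambda>(G, H). {iso_class n G, iso_class n H}) ` (graphs_of_order n \<times> graphs_of_order n)"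
    by (auto simp: cospectral_pairs_def)
qed (simp add: finite_graphs_of_order)

lemma base_pair_properties:
  assumes "i < 5"
  shows "well_formed (first_graph i)" "well_formed (second_graph i)"
    "all_on_alternating_paths (first_graph i)" "all_on_alternating_paths (second_graph i)"
    "resistance_spectrum \<lparr>pverts = {..<9}, parcs = edge_rel (first_graph i)\<rparr> =
     resistance_spectrum \<lparr>pverts = {..<9}, parcs = edge_rel (second_graph i)\<rparr>"
proof -
  obtain c es M fs N where w: "base_pairs ! i = (c, (es, M), (fs, N))" by (metis prod.exhaust)
  have "(c, (es, M), (fs, N)) \<in> set base_pairs"
    using assms unfolding w[symmetric] by (intro nth_mem) (simp add: base_pairs_def)
  then have valid: "c \<noteq> 0" "well_formed es" "well_formed fs" "grounded_table c (es, M)"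
    "grounded_table c (fs, N)" "all_on_alternating_paths es" "all_on_alternating_paths fs"
    and "sort (scaled_resistances M) = sort (scaled_resistances N)"
    using base_pairs_well_formed base_pairs_grounded base_pairs_alternating base_pairs_cospectral
    by fastforce+
  then have "mset (scaled_resistances M) = mset (scaled_resistances N)" by (metis mset_sort)
  then show "well_formed (first_graph i)" "well_formed (second_graph i)"
    "all_on_alternating_paths (first_graph i)" "all_on_alternating_paths (second_graph i)"
    "resistance_spectrum \<lparr>pverts = {..<9}, parcs = edge_rel (first_graph i)\<rparr> =
     resistance_spectrum \<lparr>pverts = {..<9}, parcs = edge_rel (second_graph i)\<rparr>"
    using valid by (simp_all add: first_graph_def second_graph_def w network_spectrum)
qed

lemma base_pair_valencies:
  assumes "i < 5" "j < 5"
  shows "sort (valencies (first_graph i)) = sort (valencies (first_graph j)) \<Longrightarrow> i = j"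
    "sort (valencies (first_graph i)) \<noteq> sort (valencies (second_graph j))"
proof -
  define vals where "vals = map (\<lambda>(c, A, B). (sort (valencies (fst A)), sort (valencies (fst B)))) base_pairs"
  have "vals ! k = (sort (valencies (first_graph k)), sort (valencies (second_graph k)))" if "k < 5" for k
  proof -
    have "k < length base_pairs" using that by (simp add: base_pairs_def)
    then show ?thesis by (simp add: vals_def first_graph_def second_graph_def case_prod_unfold)
  qed
  then have first: "sort (valencies (first_graph k)) = fst (vals ! k)"
    and second: "sort (valencies (second_graph k)) = snd (vals ! k)" if "k < 5" for k
    using that by simp_all
  have ij: "i \<in> {0, 1, 2, 3, 4}" "j \<in> {0, 1, 2, 3, 4}" using assms by auto
  show "sort (valencies (first_graph i)) = sort (valencies (first_graph j)) \<Longrightarrow> i = j"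
    "sort (valencies (first_graph i)) \<noteq> sort (valencies (second_graph j))"
    unfolding first[OF assms(1)] first[OF assms(2)] second[OF assms(2)]
    using ij unfolding vals_def base_pairs_valencies by auto
qed

theorem theorem3p5:
  fixes n :: nat
  assumes "n \<ge> 10"
  shows "2 * (n - 9) * num_partitions (n - 9) \<le> card (cospectral_pairs n)"
proof -
  let ?I = "{..<5::nat} \<times> Pow {10..<n}"
  let ?G = "\<lambda>i S. padded n (first_graph i) S" and ?H = "\<lambda>i S. padded n (second_graph i) S"
  define pair where "pair = (\<lambda>(i, S). {iso_class n (?G i S), iso_class n (?H i S)})"
  have graphs: "?G i S \<in> graphs_of_order n" "?H i S \<in> graphs_of_order n" if "i < 5" for i S
    using that assms by (simp_all add: padded_in_graphs_of_order base_pair_properties(1,2))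
  \<comment> \<open>First members never coincide with second members, so a pair of classes determines the class of
    its first member, and with it \<open>i\<close> and \<open>S\<close>.\<close>
  have first_second: "iso_class n (?G i S) \<noteq> iso_class n (?H j T)"
    if "i < 5" "j < 5" "S \<subseteq> {10..<n}" "T \<subseteq> {10..<n}" for i j S T
  proof
    assume "iso_class n (?G i S) = iso_class n (?H j T)"
    then have "profile (?G i S) = profile (?H j T)"
      by (rule iso_class_eq_imp_profile_eq[OF graphs(1)[OF that(1)] graphs(2)[OF that(2)]])
    then have "sort (valencies (first_graph i)) = sort (valencies (second_graph j))"
      using padded_profile_inject[OF base_pair_properties(1,3)[OF that(1)]
          base_pair_properties(2,4)[OF that(2)] that(3,4)] by simp
    then show False using base_pair_valencies(2)[OF that(1,2)] by simp
  qed
  have first_first: "i = j \<and> S = T"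
    if "iso_class n (?G i S) = iso_class n (?G j T)" "i < 5" "j < 5" "S \<subseteq> {10..<n}" "T \<subseteq> {10..<n}"
    for i j S T
  proof -
    have "profile (?G i S) = profile (?G j T)"
      by (rule iso_class_eq_imp_profile_eq[OF graphs(1)[OF that(2)] graphs(1)[OF that(3)] that(1)])
    then have "sort (valencies (first_graph i)) = sort (valencies (first_graph j)) \<and> S = T"
      by (rule padded_profile_inject[OF base_pair_properties(1,3)[OF that(2)]
          base_pair_properties(1,3)[OF that(3)] that(4,5)])
    then show ?thesis using base_pair_valencies(1)[OF that(2,3)] by simp
  qed
  have "inj_on pair ?I"
  proof (rule inj_onI)
    fix p q assume "p \<in> ?I" "q \<in> ?I" and eq: "pair p = pair q"
    then obtain i S j T where p: "p = (i, S)" "i < 5" "S \<subseteq> {10..<n}"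
      and q: "q = (j, T)" "j < 5" "T \<subseteq> {10..<n}" by auto
    have "iso_class n (?G i S) \<in> {iso_class n (?G j T), iso_class n (?H j T)}"
      using eq by (auto simp: pair_def p q)
    then have "iso_class n (?G i S) = iso_class n (?G j T)"
      using first_second[of i j S T] p q by simp
    then show "p = q" using first_first p q by simp
  qed
  moreover have "pair ` ?I \<subseteq> cospectral_pairs n"
  proof (rule image_subsetI)
    fix p assume "p \<in> ?I"
    then obtain i S where p: "p = (i, S)" and i: "i < 5" and S: "S \<subseteq> {10..<n}" by auto
    have "resistance_spectrum (?G i S) = resistance_spectrum (?H i S)"
      using i by (intro padded_spectrum_eq base_pair_properties) auto
    moreover have "iso_class n (?G i S) \<noteq> iso_class n (?H i S)"
      using first_second i S by simp
    ultimately show "pair p \<in> cospectral_pairs n"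
      unfolding p pair_def cospectral_pairs_def prod.case using graphs[of i] i by blast
  qed
  ultimately have "card ?I \<le> card (cospectral_pairs n)"
    using finite_cospectral_pairs by (rule card_inj_on_le)
  moreover have "card ?I = 5 * 2 ^ (n - 10)"
    by (simp add: card_cartesian_product card_Pow)
  moreover have "2 * (2 * (n - 9) * num_partitions (n - 9)) \<le> 2 * (5 * 2 ^ (n - 10))"
  proof -
    have "n - 9 = Suc (n - 10)" using assms by simp
    then have "2 * (5 * 2 ^ (n - 10)) = (5 * 2 ^ (n - 9) :: nat)" by simp
    moreover have "2 * (2 * (n - 9) * num_partitions (n - 9)) = 4 * (n - 9) * num_partitions (n - 9)"
      by simp
    ultimately show ?thesis using num_partitions_exponential_bound[of "n - 9"] by (simp only:)
  qed
  ultimately show ?thesis by linarith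
qed

end
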